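(* Let $q\in\left(0,\frac{2}{\sigma^2}(1-\bar{A}M_1)\right)$. Then the second generalized Riccati equation $$\frac{\mathrm{d}G(t,r)}{\mathrm{d}t}=-rG(t,r)-\frac{1}{2}\sigma^2 r\,(G(t,r))^2+r\int_{u=0}^{u=+\infty}A(u,r)\int_{z=0}^{z=+\infty}\left(1-e^{-G(t,u)z}\right)\nu(\mathrm{d}z)\rho(\mathrm{d}u),\quad t>0,\ r>0,$$ with initial condition $G(0,\cdot)=q$, admits a unique nonnegative solution $\varphi$ (in the mild sense defined in the context) that is bounded as $0\le\varphi(t,r)\le\bar{\varphi}(q)$ for all $t\ge 0$ and $r>0$. Moreover, this solution is continuously differentiable with respect to time at any $t>0$, and thus satisfies the equation $$\frac{\mathrm{d}\varphi(t,r)}{\mathrm{d}t}=-r\varphi(t,r)-\frac{1}{2}\sigma^2 r\,(\varphi(t,r))^2+r\int_{u=0}^{u=+\infty}A(u,r)\int_{z=0}^{z=+\infty}\left(1-e^{-\varphi(t,u)z}\right)\nu(\mathrm{d}z)\rho(\mathrm{d}u)$$ pointwise for all $t>0$ and $r>0$.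
   Context: Data and standing assumptions. $\sigma\ge 0$ is a constant (when $\sigma=0$, $2/\sigma^2$ is read as $+\infty$). $\nu$ is a Lévy measure on $(0,+\infty)$ (jumps are positive), and $M_k=\int_0^{+\infty}z^k\nu(\mathrm{d}z)$ for $k=1,2,3,\dots$. $\rho$ is a probability measure on $(0,+\infty)$. $A:(0,+\infty)^2\to[0,+\infty)$ is bounded, nonnegative and uniformly continuous. The following are assumed: (1) there is a constant $\bar{A}>0$ such that $\sup_{r,u>0}A(r,u)\le\bar{A}<+\infty$; (2) $M_1,M_2<+\infty$ and $\bar{A}M_1<1$; (3) $\rho$ admits a density that is positive and bounded at all $r>0$, and $\rho$ has a (finite) average $\int_0^{+\infty}r\rho(\mathrm{d}r)<+\infty$. The constant $\bar{\varphi}(q)$. For $q\in\left(0,\frac{2}{\sigma^2}(1-\bar{A}M_1)\right)$, $\bar{\varphi}(q)>0$ denotes the unique solution $\varphi\geq 0$ of $$\varphi=q+\frac{\bar{A}M_1+\frac{\sigma^2}{2}\varphi}{1+\frac{\sigma^2}{2}\varphi}\,\varphi ,$$ and $\eta(q)=1+\frac{\sigma^2}{2}\bar{\varphi}(q)$. Function space. For $T>0$, $C_{b,T}=\{\varphi\in C([0,T]\times(0,+\infty)):\ \|\varphi\|_T=\sup_{0\le t\le T}\sup_{r>0}|\varphi(t,r)|<+\infty\}$. Notion of (mild) solution. A solution to the second generalized Riccati equation is a function $\varphi$ on $[0,+\infty)\times(0,+\infty)$ such that, for each $T>0$, $\varphi\in C_{b,T}$ and $$\varphi(t,r)=qe^{-\eta(q)rt}+\int_{0}^{t}e^{-\eta(q)r(t-s)}\,r\left\{\frac{1}{2}\sigma^2\left(\bar{\varphi}(q)-\varphi(s,r)\right)\varphi(s,r)+\int_{u=0}^{u=+\infty}A(u,r)\int_{z=0}^{z=+\infty}\left(1-e^{-\varphi(s,u)z}\right)\nu(\mathrm{d}z)\rho(\mathrm{d}u)\right\}\mathrm{d}s$$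 for all $0\le t\le T$ and $r>0$. *)

theory Defs
  imports "HOL-Probability.Probability"
begin

definition levy_measure :: "real measure \<Rightarrow> bool" where
  "levy_measure \<nu> \<longleftrightarrow>
     sets \<nu> = sets (restrict_space borel {0<..}) \<and>
     (\<integral>\<^sup>+ z. ennreal (min 1 (z\<^sup>2)) \<partial>\<nu>) < \<infinity>"

text \<open>Bochner integral, hence meaningful only where \<open>\<lambda>z. z ^ k\<close> is \<open>\<nu>\<close>-integrable
  (that is, where the k-th moment is finite).\<close>

definition moment :: "real measure \<Rightarrow> nat \<Rightarrow> real" where
  "moment \<nu> k = (\<integral>z. z ^ k \<partial>\<nu>)"

definition has_bounded_positive_density :: "real measure \<Rightarrow> bool" where
  "has_bounded_positive_density \<rho> \<longleftrightarrow>
     (\<exists>(f :: real \<Rightarrow> real) C.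
        f \<in> borel_measurable (restrict_space borel {0<..}) \<and>
        \<rho> = density (restrict_space lborel {0<..}) (\<lambda>r. ennreal (f r)) \<and>
        (\<forall>r>0. 0 < f r \<and> f r \<le> C))"

text \<open>The interval of admissible \<open>q\<close>; its upper end \<open>2 / \<sigma>\<^sup>2 * (1 - Abar * M\<^sub>1)\<close> is infinite
  for \<open>\<sigma> = 0\<close>.\<close>

definition q_range :: "real \<Rightarrow> real measure \<Rightarrow> real \<Rightarrow> real set" where
  "q_range \<sigma> \<nu> Abar =
     (if \<sigma> = 0 then {0<..} else {0 <..< 2 / \<sigma>\<^sup>2 * (1 - Abar * moment \<nu> 1)})"

definition is_phi_bar :: "real \<Rightarrow> real measure \<Rightarrow> real \<Rightarrow> real \<Rightarrow> real \<Rightarrow> bool" where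
  "is_phi_bar \<sigma> \<nu> Abar q x \<longleftrightarrow>
     0 \<le> x \<and>
     x = q + (Abar * moment \<nu> 1 + \<sigma>\<^sup>2 / 2 * x) / (1 + \<sigma>\<^sup>2 / 2 * x) * x"

definition phi_bar :: "real \<Rightarrow> real measure \<Rightarrow> real \<Rightarrow> real \<Rightarrow> real" where
  "phi_bar \<sigma> \<nu> Abar q = (THE x. is_phi_bar \<sigma> \<nu> Abar q x)"

lemma is_phi_bar_iff:
  assumes "Abar * moment \<nu> 1 < 1" "q \<in> q_range \<sigma> \<nu> Abar"
  shows "is_phi_bar \<sigma> \<nu> Abar q x \<longleftrightarrow> x = q / (1 - Abar * moment \<nu> 1 - \<sigma>\<^sup>2 / 2 * q)"
proof -
  define m a where "m = Abar * moment \<nu> 1" and "a = \<sigma>\<^sup>2 / 2"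
  have a0: "0 \<le> a" by (simp add: a_def)
  have q0: "0 < q" using assms(2) by (auto simp: q_range_def split: if_splits)
  have d: "0 < 1 - m - a * q"
  proof (cases "\<sigma> = 0")
    case True
    then show ?thesis using assms(1) by (simp add: m_def a_def)
  next
    case False
    then have "q < 2 / \<sigma>\<^sup>2 * (1 - m)" using assms(2) by (simp add: q_range_def m_def)
    with False show ?thesis by (simp add: a_def field_simps)
  qed
  have eq: "(x = q + (m + a * x) / (1 + a * x) * x) = (x = q / (1 - m - a * q))" if "0 \<le> x"
  proof -
    have p: "0 < 1 + a * x" using a0 that by (simp add: add_pos_nonneg)
    have "(x = q + (m + a * x) / (1 + a * x) * x) =
          (x * (1 + a * x) = q * (1 + a * x) + (m + a * x) * x)"
      using p by (simp add: divide_simps)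
    also have "\<dots> = (x * (1 - m - a * q) = q)"
      by (auto simp: algebra_simps)
    also have "\<dots> = (x = q / (1 - m - a * q))"
      using d by (simp add: eq_divide_eq)
    finally show ?thesis .
  qed
  have "0 \<le> q / (1 - m - a * q)" using d q0 by simp
  with eq show ?thesis unfolding is_phi_bar_def m_def[symmetric] a_def[symmetric] by blast
qed

lemma phi_bar_unique:
  assumes "Abar * moment \<nu> 1 < 1" "q \<in> q_range \<sigma> \<nu> Abar"
  shows "\<exists>!x. is_phi_bar \<sigma> \<nu> Abar q x"
  by (simp add: is_phi_bar_iff[OF assms])

definition eta :: "real \<Rightarrow> real measure \<Rightarrow> real \<Rightarrow> real \<Rightarrow> real" where
  "eta \<sigma> \<nu> Abar q = 1 + \<sigma>\<^sup>2 / 2 * phi_bar \<sigma> \<nu> Abar q"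

definition Cb :: "real \<Rightarrow> (real \<Rightarrow> real \<Rightarrow> real) set" where
  "Cb T = {\<phi>. continuous_on ({0..T} \<times> {0<..}) (\<lambda>(t, r). \<phi> t r) \<and>
               bounded ((\<lambda>(t, r). \<phi> t r) ` ({0..T} \<times> {0<..}))}"

text \<open>For nonnegative \<open>g\<close> bounded on \<open>{0<..}\<close> and measurable there, both integrals converge
  as soon as the first moment of \<open>\<nu>\<close> is finite and \<open>A\<close> is bounded.\<close>

definition jump_term ::
  "real measure \<Rightarrow> real measure \<Rightarrow> (real \<Rightarrow> real \<Rightarrow> real) \<Rightarrow> (real \<Rightarrow> real) \<Rightarrow> real \<Rightarrow> real" where
  "jump_term \<nu> \<rho> A g r = (\<integral>u. A u r * (\<integral>z. (1 - exp (- g u * z)) \<partial>\<nu>) \<partial>\<rho>)"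

definition riccati_rhs ::
  "real \<Rightarrow> real measure \<Rightarrow> real measure \<Rightarrow> (real \<Rightarrow> real \<Rightarrow> real) \<Rightarrow> (real \<Rightarrow> real) \<Rightarrow> real \<Rightarrow> real" where
  "riccati_rhs \<sigma> \<nu> \<rho> A g r =
     - r * g r - 1 / 2 * \<sigma>\<^sup>2 * r * (g r)\<^sup>2 + r * jump_term \<nu> \<rho> A g r"

definition mild_solution ::
  "real \<Rightarrow> real measure \<Rightarrow> real measure \<Rightarrow> (real \<Rightarrow> real \<Rightarrow> real) \<Rightarrow> real \<Rightarrow> real \<Rightarrow>
   (real \<Rightarrow> real \<Rightarrow> real) \<Rightarrow> bool" where
  "mild_solution \<sigma> \<nu> \<rho> A Abar q \<phi> \<longleftrightarrow>
     (\<forall>T>0. \<phi> \<in> Cb T \<and>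
       (\<forall>t\<in>{0..T}. \<forall>r>0.
         \<phi> t r = q * exp (- eta \<sigma> \<nu> Abar q * r * t) +
           integral {0..t} (\<lambda>s. exp (- eta \<sigma> \<nu> Abar q * r * (t - s)) * r *
             (1 / 2 * \<sigma>\<^sup>2 * (phi_bar \<sigma> \<nu> Abar q - \<phi> s r) * \<phi> s r
              + jump_term \<nu> \<rho> A (\<phi> s) r))))"

end

theory Submission
  imports Defs
begin

text \<open>Write \<open>m = Abar M\<^sub>1\<close> and \<open>B = phi_bar\<close>. On functions with values in \<open>[0, B]\<close> the source term
  of the mild equation is Lipschitz with constant \<open>m + \<sigma>\<^sup>2/2 B\<close>, while the kernel
  \<open>r exp (- \<eta> r (t - s))\<close> has mass at most \<open>1 / \<eta>\<close> with \<open>\<eta> = 1 + \<sigma>\<^sup>2/2 B\<close>. As \<open>m < 1\<close>, the mild map is a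
  contraction for the supremum norm over all times at once, and the equation defining \<open>B\<close> says
  exactly that it preserves the bound \<open>B\<close>. Uniqueness needs no a priori upper bound: by a maximum
  principle in \<open>t\<close> for each fixed \<open>r\<close>, the supremum \<open>S\<close> of the difference of two nonnegative solutions over
  \<open>[0, T]\<close> satisfies \<open>S \<le> m S\<close>.\<close>

section \<open>Maximum principle in one variable, and sections of jointly continuous
  functions\<close>

text \<open>A maximum point of \<open>D\<close> with value above \<open>K\<close> cannot be
  \<open>0\<close>, and a negative derivative there would make \<open>D\<close> larger slightly to
  the left. Only points on the left are compared, so the maximum may sit at
  \<open>T\<close>.\<close>

lemma bounded_by_if_derivative_neg_above:
  fixes D :: "real \<Rightarrow> real"
  assumes cont: "continuous_on {0..T} D" and init: "D 0 \<le> K"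
    and neg: "\<And>t. 0 < t \<Longrightarrow> t \<le> T \<Longrightarrow> K < D t \<Longrightarrow>
                \<exists>l<0. (D has_real_derivative l) (at t)"
    and t: "t \<in> {0..T}"
  shows "D t \<le> K"
proof (rule ccontr)
  assume "\<not> D t \<le> K"
  obtain m where m: "m \<in> {0..T}" "\<And>s. s \<in> {0..T} \<Longrightarrow> D s \<le> D m"
    using continuous_attains_sup[OF compact_Icc _ cont] t by blast
  have "K < D m" using m(2)[OF t] \<open>\<not> D t \<le> K\<close> by linarith
  with init have "m \<noteq> 0" by auto
  with m have m0: "0 < m" "m \<le> T" by auto
  then obtain l where "l < 0" "(D has_real_derivative l) (at m)"
    using neg \<open>K < D m\<close> by blast
  then obtain d where d: "0 < d" "\<And>h. 0 < h \<Longrightarrow> h < d \<Longrightarrow> D m < D (m - h)"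
    using DERIV_neg_dec_left by blast
  define h where "h = min (d / 2) m"
  have "0 < h" "h < d" "m - h \<in> {0..T}" using d(1) m0 by (auto simp: h_def)
  with d(2)[of h] m(2)[of "m - h"] show False by force
qed

lemma continuous_on_section:
  assumes "continuous_on (S \<times> {0<..}) (\<lambda>(s, u). g s u)" "s \<in> S"
  shows "continuous_on {0<..} (g s :: real \<Rightarrow> real)"
proof -
  have "continuous_on {0<..} (\<lambda>u. (\<lambda>(s, u). g s u) (s, u))"
    by (rule continuous_on_compose2[OF assms(1)]) (use assms in \<open>auto intro!: continuous_intros\<close>)
  then show ?thesis by simp
qed

lemma continuous_on_section2:
  fixes g :: "real \<Rightarrow> real \<Rightarrow> real"
  assumes "continuous_on (S \<times> {0<..}) (\<lambda>(s, u). g s u)" "0 < u" "S' \<subseteq> S"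
  shows "continuous_on S' (\<lambda>s. g s u)"
proof -
  have "continuous_on S' (\<lambda>s. (\<lambda>(s, u). g s u) (s, u))"
    by (rule continuous_on_compose2[OF assms(1)]) (use assms in \<open>auto intro!: continuous_intros\<close>)
  then show ?thesis by simp
qed

section \<open>The Duhamel formula with an abstract source\<close>

text \<open>Variation of constants for \<open>y' = - \<eta> * r * y + r * h\<close> with
  \<open>y 0 = q\<close>. Keeping the source abstract separates the kernel estimates from the
  Riccati nonlinearity.\<close>

definition duhamel :: "real \<Rightarrow> real \<Rightarrow> (real \<Rightarrow> real \<Rightarrow> real) \<Rightarrow> real \<Rightarrow> real \<Rightarrow> real" where
  "duhamel \<eta> q h t r =
     q * exp (- \<eta> * r * t) + integral {0..t} (\<lambda>s. exp (- \<eta> * r * (t - s)) * r * h s r)"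

text \<open>The antiderivative in \<open>s\<close> is
  \<open>k / \<eta> * exp (- \<eta> * r * (t - s))\<close>. The prefactor \<open>r\<close> cancels
  against the rate, which keeps the kernel mass below \<open>1 / \<eta>\<close> for every positive
  \<open>r\<close>.\<close>

lemma duhamel_kernel_has_integral:
  fixes \<eta> r t k :: real
  assumes "0 < \<eta>" "0 \<le> t"
  shows "((\<lambda>s. exp (- \<eta> * r * (t - s)) * r * k) has_integral k / \<eta> * (1 - exp (- \<eta> * r * t))) {0..t}"
proof -
  have "((\<lambda>s. exp (- \<eta> * r * (t - s)) * r * k) has_integral
      (k / \<eta> * exp (- \<eta> * r * (t - t)) - k / \<eta> * exp (- \<eta> * r * (t - 0)))) {0..t}"
    by (rule fundamental_theorem_of_calculus)
       (use assms in \<open>auto intro!: derivative_eq_intros simp: has_real_derivative_iff_has_vector_derivative[symmetric]\<close>)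
  then show ?thesis by (simp add: algebra_simps)
qed

lemma duhamel_upper_bound:
  assumes "0 < \<eta>" "0 \<le> t" "0 < r" "continuous_on {0..t} (\<lambda>s. h s r)"
    and "\<And>s. s \<in> {0..t} \<Longrightarrow> h s r \<le> k"
  shows "duhamel \<eta> q h t r \<le> q * exp (- \<eta> * r * t) + k / \<eta> * (1 - exp (- \<eta> * r * t))"
proof -
  have "(\<lambda>s. exp (- \<eta> * r * (t - s)) * r * h s r) integrable_on {0..t}"
    by (intro integrable_continuous_real continuous_intros assms)
  then have "integral {0..t} (\<lambda>s. exp (- \<eta> * r * (t - s)) * r * h s r)
      \<le> k / \<eta> * (1 - exp (- \<eta> * r * t))"
    using assms by (intro has_integral_le[OF integrable_integral duhamel_kernel_has_integral])
      (auto intro!: mult_left_mono)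
  then show ?thesis by (simp add: duhamel_def)
qed

lemma duhamel_diff:
  assumes "continuous_on {0..t} (\<lambda>s. h s r)" "continuous_on {0..t} (\<lambda>s. k s r)"
  shows "duhamel \<eta> q h t r - duhamel \<eta> q k t r = duhamel \<eta> 0 (\<lambda>s r. h s r - k s r) t r"
proof -
  have "(\<lambda>s. exp (- \<eta> * r * (t - s)) * r * h s r) integrable_on {0..t}"
    "(\<lambda>s. exp (- \<eta> * r * (t - s)) * r * k s r) integrable_on {0..t}"
    by (intro integrable_continuous_real continuous_intros assms)+
  then show ?thesis
    by (simp add: duhamel_def integral_diff[symmetric] right_diff_distrib)
qed

text \<open>Dropping the exponential makes the bound uniform in \<open>t\<close> and
  \<open>r\<close>, as a contraction over all times requires.\<close>

lemma duhamel_zero_upper_bound: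
  assumes "0 < \<eta>" "0 \<le> t" "0 < r" "continuous_on {0..t} (\<lambda>s. h s r)"
    and "\<And>s. s \<in> {0..t} \<Longrightarrow> h s r \<le> k" and "0 \<le> k"
  shows "duhamel \<eta> 0 h t r \<le> k / \<eta>"
proof -
  have "duhamel \<eta> 0 h t r \<le> k / \<eta> * (1 - exp (- \<eta> * r * t))"
    using duhamel_upper_bound[of \<eta> t r h k 0] assms by simp
  also have "\<dots> \<le> k / \<eta>" using assms by (intro mult_left_le) auto
  finally show ?thesis .
qed

lemma duhamel_nonneg:
  assumes "0 < r" "0 \<le> q" "continuous_on {0..t} (\<lambda>s. h s r)"
    and "\<And>s. s \<in> {0..t} \<Longrightarrow> 0 \<le> h s r"
  shows "0 \<le> duhamel \<eta> q h t r"
  unfolding duhamel_def using assms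
  by (intro add_nonneg_nonneg Henstock_Kurzweil_Integration.integral_nonneg
      integrable_continuous_real continuous_intros) auto

text \<open>Once \<open>exp (- \<eta> * r * t)\<close> is factored out, the remaining integrand is
  free of \<open>t\<close>; the fundamental theorem of calculus and the product rule then
  apply.\<close>

lemma duhamel_has_derivative:
  assumes cont: "continuous_on {0..T} (\<lambda>s. h s r)" and t: "0 < t" "t < T"
  shows "((\<lambda>t. duhamel \<eta> q h t r) has_real_derivative (- \<eta> * r * duhamel \<eta> q h t r + r * h t r)) (at t)"
proof -
  define I where "I = (\<lambda>t. integral {0..t} (\<lambda>s. exp (\<eta> * r * s) * (r * h s r)))"
  have eq: "duhamel \<eta> q h t r = exp (- \<eta> * r * t) * (q + I t)" for t
  proof -
    have "integral {0..t} (\<lambda>s. exp (- \<eta> * r * (t - s)) * r * h s r) =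
        integral {0..t} (\<lambda>s. exp (- \<eta> * r * t) * (exp (\<eta> * r * s) * (r * h s r)))"
      by (rule integral_cong) (simp add: mult_exp_exp algebra_simps)
    then show ?thesis by (simp only: duhamel_def I_def integral_mult_right) (simp add: algebra_simps)
  qed
  have "(I has_real_derivative exp (\<eta> * r * t) * (r * h t r)) (at t within {0..T})"
    unfolding I_def using t
    by (intro integral_has_real_derivative continuous_intros cont) auto
  \<comment> \<open>Since \<open>t\<close> is interior to \<open>{0..T}\<close>, the derivative
    within the interval is a two-sided one.\<close>
  then have I: "(I has_real_derivative exp (\<eta> * r * t) * (r * h t r)) (at t)"
    using t by (simp add: at_within_Icc_at)
  have "((\<lambda>t. exp (- \<eta> * r * t) * (q + I t)) has_real_derivative
      - \<eta> * r * (exp (- \<eta> * r * t) * (q + I t)) + exp (- \<eta> * r * t) * exp (\<eta> * r * t) * (r * h t r)) (at t)"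
    by (auto intro!: derivative_eq_intros I simp: algebra_simps)
  then show ?thesis unfolding eq by (simp add: exp_add[symmetric])
qed

text \<open>The domain of integration moves with \<open>t\<close>. The substitution
  \<open>s = t * x\<close> carries it to \<open>{0..1}\<close>, where continuity of integrals
  depending on a parameter applies.\<close>

lemma duhamel_continuous:
  assumes cont: "continuous_on ({0..} \<times> {0<..}) (\<lambda>(s, r). h s r)"
  shows "continuous_on ({0..} \<times> {0<..}) (\<lambda>(t, r). duhamel \<eta> q h t r)"
proof -
  \<comment> \<open>The integrand after substitution; the leading \<open>fst p\<close> is the
    Jacobian.\<close>
  define F where "F = (\<lambda>p x. fst p * (exp (- \<eta> * snd p * (fst p * (1 - x))) * snd p * h (fst p * x) (snd p)))"
  have "continuous_on (({0..} \<times> {0<..}) \<times> {0..1}) (\<lambda>y. (\<lambda>(s, r). h s r) (fst (fst y) * snd y, snd (fst y)))"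
    by (rule continuous_on_compose2[OF cont]) (auto intro!: continuous_intros)
  then have "continuous_on (({0..} \<times> {0<..}) \<times> cbox 0 1) (\<lambda>(p, x). F p x)"
    unfolding F_def split_beta by (auto intro!: continuous_intros)
  then have *: "continuous_on ({0..} \<times> {0<..}) (\<lambda>p. integral (cbox 0 1) (F p))"
    by (rule integral_continuous_on_param)
  have "integral {0..1} (F (t, r)) = integral {0..t} (\<lambda>s. exp (- \<eta> * r * (t - s)) * r * h s r)"
    if "0 \<le> t" "0 < r" for t r
  \<comment> \<open>Stretching by \<open>t\<close> is invertible only for
    \<open>t \<noteq> 0\<close>; at \<open>t = 0\<close> both integrals vanish.\<close>
  proof (cases "t = 0")
    case True then show ?thesis by (simp add: F_def)
  next
    case False
    let ?g = "\<lambda>s. exp (- \<eta> * r * (t - s)) * r * h s r"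
    have "continuous_on {0..t} (\<lambda>s. (\<lambda>(s, r). h s r) (s, r))"
      by (rule continuous_on_compose2[OF cont]) (use that in \<open>auto intro!: continuous_intros\<close>)
    then have "?g integrable_on {0..t}"
      by (intro integrable_continuous_real continuous_intros) auto
    then have "(?g has_integral integral {0..t} ?g) {0..t}" by (rule integrable_integral)
    from has_integral_stretch_real[OF this, of t] False that
    have "((\<lambda>x. ?g (t * x)) has_integral integral {0..t} ?g / t) {0..1}"
      by simp
    from has_integral_mult_right[OF this, of t] False
    have "(F (t, r) has_integral integral {0..t} ?g) {0..1}"
      by (simp add: F_def algebra_simps)
    then show ?thesis by (rule integral_unique)
  qed
  then have "continuous_on ({0..} \<times> {0<..}) (\<lambda>(t, r). integral {0..t} (\<lambda>s. exp (- \<eta> * r * (t - s)) * r * h s r))"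
    by (intro continuous_on_cong[THEN iffD1, OF refl _ *]) auto
  then show ?thesis
    unfolding duhamel_def split_beta by (auto intro!: continuous_intros)
qed


section \<open>The Laplace exponent of the jump measure and the nonlocal jump term\<close>

definition levy_exponent :: "real measure \<Rightarrow> real \<Rightarrow> real" where
  "levy_exponent \<nu> x = (\<integral>z. (1 - exp (- x * z)) \<partial>\<nu>)"

text \<open>For \<open>x \<le> y\<close> factor out \<open>exp (- x * z) \<le> 1\<close> and use
  \<open>1 - exp (- a) \<le> a\<close>; the other order is symmetric.\<close>

lemma exp_uminus_lipschitz:
  fixes x y z :: real
  assumes "0 \<le> x" "0 \<le> y" "0 \<le> z"
  shows "\<bar>exp (- x * z) - exp (- y * z)\<bar> \<le> z * \<bar>x - y\<bar>"
proof -
  have *: "exp (- x * z) - exp (- y * z) \<le> z * (y - x)" if "0 \<le> x" "x \<le> y" for x y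
  proof -
    have "exp (- x * z) - exp (- y * z) = exp (- x * z) * (1 - exp (- (y - x) * z))"
      by (simp add: right_diff_distrib mult_exp_exp algebra_simps)
    also have "\<dots> \<le> 1 * (z * (y - x))"
    proof (rule mult_mono)
      show "1 - exp (- (y - x) * z) \<le> z * (y - x)"
        using exp_ge_add_one_self[of "- (y - x) * z"] by (simp add: algebra_simps)
    qed (use that assms in \<open>auto simp: mult_nonpos_nonneg\<close>)
    finally show ?thesis by simp
  qed
  have anti: "exp (- y * z) \<le> exp (- x * z)" if "x \<le> y" for x y
    using that assms by (simp add: mult_right_mono)
  show ?thesis
  proof (cases "x \<le> y")
    case True
    then show ?thesis using *[of x y] anti[of x y] assms by simp
  next
    case False
    then show ?thesis using *[of y x] anti[of y x] assms by simp
  qed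
qed

locale jump_data =
  fixes \<nu> \<rho> :: "real measure" and A :: "real \<Rightarrow> real \<Rightarrow> real" and Abar :: real
  assumes sets_nu: "sets \<nu> = sets (restrict_space borel {0<..})"
    and sets_rho: "sets \<rho> = sets (restrict_space borel {0<..})"
    and prob_rho: "prob_space \<rho>"
    and nu_moment: "integrable \<nu> (\<lambda>z. z)"
    and A_nonneg: "\<And>r u. 0 < r \<Longrightarrow> 0 < u \<Longrightarrow> 0 \<le> A r u"
    and A_le: "\<And>r u. 0 < r \<Longrightarrow> 0 < u \<Longrightarrow> A r u \<le> Abar"
    and A_cont: "continuous_on ({0<..} \<times> {0<..}) (\<lambda>(r, u). A r u)"
begin

sublocale rho: prob_space \<rho> by (rule prob_rho)

lemma space_nu: "space \<nu> = {0<..}"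
  using sets_eq_imp_space_eq[OF sets_nu] by (simp add: space_restrict_space)

lemma space_rho: "space \<rho> = {0<..}"
  using sets_eq_imp_space_eq[OF sets_rho] by (simp add: space_restrict_space)

lemma Abar_nonneg: "0 \<le> Abar"
  using A_nonneg[of 1 1] A_le[of 1 1] by simp

lemma moment_1: "moment \<nu> 1 = (\<integral>z. z \<partial>\<nu>)"
  by (simp add: moment_def)

lemma moment_1_nonneg: "0 \<le> moment \<nu> 1"
  unfolding moment_1 by (rule Bochner_Integration.integral_nonneg_AE) (auto simp: space_nu)

lemma borel_measurable_nu:
  fixes f :: "real \<Rightarrow> real"
  shows "continuous_on {0<..} f \<Longrightarrow> f \<in> borel_measurable \<nu>"
  using borel_measurable_continuous_on_restrict measurable_cong_sets[OF sets_nu refl] by blast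

lemma borel_measurable_rho:
  fixes f :: "real \<Rightarrow> real"
  shows "continuous_on {0<..} f \<Longrightarrow> f \<in> borel_measurable \<rho>"
  using borel_measurable_continuous_on_restrict measurable_cong_sets[OF sets_rho refl] by blast

text \<open>\<open>\<nu>\<close> may have infinite mass near zero, so a constant cannot dominate;
  \<open>x * z\<close> does, by comparison with the exponent \<open>0\<close>, and has a finite
  integral.\<close>

lemma levy_integrand_integrable:
  assumes "0 \<le> x"
  shows "integrable \<nu> (\<lambda>z. 1 - exp (- x * z))"
proof (rule Bochner_Integration.integrable_bound)
  show "integrable \<nu> (\<lambda>z. x * z)" using nu_moment by simp
  show "AE z in \<nu>. norm (1 - exp (- x * z)) \<le> norm (x * z)"
    using exp_uminus_lipschitz[OF assms, of 0] assms
    by (auto simp: space_nu abs_mult abs_minus_commute mult.commute)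
qed (auto intro!: borel_measurable_nu continuous_intros)

text \<open>Integrating the pointwise Lipschitz bound in \<open>z\<close> turns its factor
  \<open>z\<close> into the first moment.\<close>

lemma levy_exponent_lipschitz:
  assumes "0 \<le> x" "0 \<le> y"
  shows "\<bar>levy_exponent \<nu> x - levy_exponent \<nu> y\<bar> \<le> moment \<nu> 1 * \<bar>x - y\<bar>"
proof -
  note int = levy_integrand_integrable[OF assms(1)] levy_integrand_integrable[OF assms(2)]
  have "levy_exponent \<nu> x - levy_exponent \<nu> y =
      (\<integral>z. (1 - exp (- x * z)) - (1 - exp (- y * z)) \<partial>\<nu>)"
    unfolding levy_exponent_def by (rule Bochner_Integration.integral_diff[OF int, symmetric])
  also have "\<bar>\<dots>\<bar> \<le> (\<integral>z. \<bar>(1 - exp (- x * z)) - (1 - exp (- y * z))\<bar> \<partial>\<nu>)"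
    by (rule integral_abs_bound)
  also have "\<dots> \<le> (\<integral>z. z * \<bar>x - y\<bar> \<partial>\<nu>)"
  proof (rule integral_mono)
    show "integrable \<nu> (\<lambda>z. \<bar>(1 - exp (- x * z)) - (1 - exp (- y * z))\<bar>)"
      by (rule integrable_abs[OF Bochner_Integration.integrable_diff[OF int]])
    show "integrable \<nu> (\<lambda>z. z * \<bar>x - y\<bar>)" using nu_moment by simp
    show "\<bar>(1 - exp (- x * z)) - (1 - exp (- y * z))\<bar> \<le> z * \<bar>x - y\<bar>" if "z \<in> space \<nu>" for z
      using exp_uminus_lipschitz[OF assms, of z] that by (auto simp: space_nu)
  qed
  also have "\<dots> = moment \<nu> 1 * \<bar>x - y\<bar>" unfolding moment_1 by simp
  finally show ?thesis .
qed

lemma levy_exponent_0: "levy_exponent \<nu> 0 = 0"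
  by (simp add: levy_exponent_def)

lemma levy_exponent_nonneg: "0 \<le> x \<Longrightarrow> 0 \<le> levy_exponent \<nu> x"
  unfolding levy_exponent_def by (rule Bochner_Integration.integral_nonneg_AE) (auto simp: space_nu)

lemma levy_exponent_le: "0 \<le> x \<Longrightarrow> levy_exponent \<nu> x \<le> moment \<nu> 1 * x"
  using levy_exponent_lipschitz[of x 0] by (simp add: levy_exponent_0)

lemma levy_exponent_continuous: "continuous_on {0..} (levy_exponent \<nu>)"
proof -
  have "(moment \<nu> 1)-lipschitz_on {0..} (levy_exponent \<nu>)"
    using levy_exponent_lipschitz moment_1_nonneg by (intro lipschitz_onI) (auto simp: dist_real_def)
  then show ?thesis by (rule lipschitz_on_continuous_on)
qed

lemma jump_term_eq: "jump_term \<nu> \<rho> A g r = (\<integral>u. A u r * levy_exponent \<nu> (g u) \<partial>\<rho>)"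
  by (simp add: jump_term_def levy_exponent_def)

lemma jump_integrand_measurable:
  assumes "continuous_on {0<..} g" "\<And>u. 0 < u \<Longrightarrow> 0 \<le> g u" "0 < r"
  shows "(\<lambda>u. A u r * levy_exponent \<nu> (g u)) \<in> borel_measurable \<rho>"
proof (intro borel_measurable_rho continuous_on_mult)
  have "continuous_on {0<..} (\<lambda>u. (\<lambda>(r, u). A r u) (u, r))"
    by (rule continuous_on_compose2[OF A_cont]) (use assms in \<open>auto intro!: continuous_intros\<close>)
  then show "continuous_on {0<..} (\<lambda>u. A u r)" by simp
  show "continuous_on {0<..} (\<lambda>u. levy_exponent \<nu> (g u))"
    by (rule continuous_on_compose2[OF levy_exponent_continuous]) (use assms in auto)
qed

lemma jump_integrand_bound:
  assumes "0 \<le> x" "x \<le> K" "0 < u" "0 < r"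
  shows "0 \<le> A u r * levy_exponent \<nu> x" "A u r * levy_exponent \<nu> x \<le> Abar * moment \<nu> 1 * K"
proof -
  show "0 \<le> A u r * levy_exponent \<nu> x" using assms A_nonneg levy_exponent_nonneg by simp
  have "levy_exponent \<nu> x \<le> moment \<nu> 1 * K"
    using levy_exponent_le[OF assms(1)] mult_left_mono[OF assms(2) moment_1_nonneg] by linarith
  then have "A u r * levy_exponent \<nu> x \<le> Abar * (moment \<nu> 1 * K)"
    using assms A_nonneg A_le levy_exponent_nonneg Abar_nonneg by (intro mult_mono) auto
  then show "A u r * levy_exponent \<nu> x \<le> Abar * moment \<nu> 1 * K" by (simp add: mult.assoc)
qed

lemma jump_integrand_integrable:
  assumes "continuous_on {0<..} g" "\<And>u. 0 < u \<Longrightarrow> 0 \<le> g u" "\<And>u. 0 < u \<Longrightarrow> g u \<le> K" "0 < r"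
  shows "integrable \<rho> (\<lambda>u. A u r * levy_exponent \<nu> (g u))"
  using assms jump_integrand_bound[OF assms(2,3)]
  by (intro rho.integrable_const_bound[where B = "Abar * moment \<nu> 1 * K"] jump_integrand_measurable)
     (auto simp: space_rho)

lemma jump_term_bounds:
  assumes "continuous_on {0<..} g" "\<And>u. 0 < u \<Longrightarrow> 0 \<le> g u" "\<And>u. 0 < u \<Longrightarrow> g u \<le> K" "0 < r"
  shows "0 \<le> jump_term \<nu> \<rho> A g r" "jump_term \<nu> \<rho> A g r \<le> Abar * moment \<nu> 1 * K"
proof -
  show "0 \<le> jump_term \<nu> \<rho> A g r"
    unfolding jump_term_eq using assms jump_integrand_bound[OF assms(2,3)]
    by (intro Bochner_Integration.integral_nonneg_AE) (auto simp: space_rho)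
  show "jump_term \<nu> \<rho> A g r \<le> Abar * moment \<nu> 1 * K"
    unfolding jump_term_eq using assms jump_integrand_bound[OF assms(2,3)]
    by (intro rho.integral_le_const jump_integrand_integrable) (auto simp: space_rho)
qed

text \<open>Averaging over the probability measure \<open>\<rho>\<close> preserves a pointwise
  bound. The constant does not depend on \<open>K\<close> and \<open>L\<close>, which only secure
  integrability; uniqueness relies on this.\<close>

lemma jump_term_diff:
  assumes g: "continuous_on {0<..} g" "\<And>u. 0 < u \<Longrightarrow> 0 \<le> g u" "\<And>u. 0 < u \<Longrightarrow> g u \<le> K"
    and h: "continuous_on {0<..} h" "\<And>u. 0 < u \<Longrightarrow> 0 \<le> h u" "\<And>u. 0 < u \<Longrightarrow> h u \<le> L"
    and d: "\<And>u. 0 < u \<Longrightarrow> \<bar>g u - h u\<bar> \<le> d" and r: "0 < r"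
  shows "\<bar>jump_term \<nu> \<rho> A g r - jump_term \<nu> \<rho> A h r\<bar> \<le> Abar * moment \<nu> 1 * d"
proof -
  let ?G = "\<lambda>u. A u r * levy_exponent \<nu> (g u)" and ?H = "\<lambda>u. A u r * levy_exponent \<nu> (h u)"
  have int: "integrable \<rho> ?G" "integrable \<rho> ?H"
    using jump_integrand_integrable[OF g r] jump_integrand_integrable[OF h r] by auto
  have "\<bar>?G u - ?H u\<bar> \<le> Abar * moment \<nu> 1 * d" if "0 < u" for u
  proof -
    have "\<bar>levy_exponent \<nu> (g u) - levy_exponent \<nu> (h u)\<bar> \<le> moment \<nu> 1 * d"
      using levy_exponent_lipschitz[of "g u" "h u"] g h that
        mult_left_mono[OF d[OF that] moment_1_nonneg] by fastforce
    then have "A u r * \<bar>levy_exponent \<nu> (g u) - levy_exponent \<nu> (h u)\<bar> \<le> Abar * (moment \<nu> 1 * d)"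
      using A_nonneg A_le that r Abar_nonneg by (intro mult_mono) auto
    then show ?thesis
      using A_nonneg[of u r] that r by (simp add: right_diff_distrib[symmetric] abs_mult mult.assoc)
  qed
  then have "(\<integral>u. \<bar>?G u - ?H u\<bar> \<partial>\<rho>) \<le> Abar * moment \<nu> 1 * d"
    using int by (intro rho.integral_le_const integrable_abs Bochner_Integration.integrable_diff)
       (auto simp: space_rho)
  moreover have "\<bar>\<integral>u. ?G u - ?H u \<partial>\<rho>\<bar> \<le> (\<integral>u. \<bar>?G u - ?H u\<bar> \<partial>\<rho>)"
    by (rule integral_abs_bound)
  ultimately show ?thesis
    unfolding jump_term_eq using int by simp
qed

text \<open>Dominated convergence along sequences: the integrand converges for each fixed
  \<open>u\<close>, and a constant dominates because \<open>\<rho>\<close> is finite.\<close>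

lemma jump_term_continuous:
  fixes S :: "real set"
  assumes cont: "continuous_on (S \<times> {0<..}) (\<lambda>(s, u). g s u)"
    and bounds: "\<And>s u. s \<in> S \<Longrightarrow> 0 < u \<Longrightarrow> 0 \<le> g s u" "\<And>s u. s \<in> S \<Longrightarrow> 0 < u \<Longrightarrow> g s u \<le> K"
  shows "continuous_on (S \<times> {0<..}) (\<lambda>(s, r). jump_term \<nu> \<rho> A (g s) r)"
  unfolding continuous_on_sequentially
proof (intro allI ballI impI, elim conjE)
  fix x :: "nat \<Rightarrow> real \<times> real" and a
  assume a: "a \<in> S \<times> {0<..}" and x: "\<forall>n. x n \<in> S \<times> {0<..}" and lim: "x \<longlonglongrightarrow> a"
  have gc: "continuous_on {0<..} (g s)" if "s \<in> S" for s
  proof -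
    have "continuous_on {0<..} (\<lambda>u. (\<lambda>(s, u). g s u) (s, u))"
      by (rule continuous_on_compose2[OF cont]) (use that in \<open>auto intro!: continuous_intros\<close>)
    then show ?thesis by simp
  qed
  have xS: "fst (x n) \<in> S" "0 < snd (x n)" for n using x[rule_format, of n] by (auto simp: mem_Times_iff)
  have aS: "fst a \<in> S" "0 < snd a" using a by (auto simp: mem_Times_iff)
  have "(\<lambda>n. \<integral>u. A u (snd (x n)) * levy_exponent \<nu> (g (fst (x n)) u) \<partial>\<rho>) \<longlonglongrightarrow>
      (\<integral>u. A u (snd a) * levy_exponent \<nu> (g (fst a) u) \<partial>\<rho>)"
  proof (rule integral_dominated_convergence)
    show "integrable \<rho> (\<lambda>u. Abar * moment \<nu> 1 * K)" by simp
    show "AE u in \<rho>. norm (A u (snd (x n)) * levy_exponent \<nu> (g (fst (x n)) u)) \<le> Abar * moment \<nu> 1 * K" for n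
      using jump_integrand_bound[OF bounds, OF xS(1) _ xS(1)] xS by (auto simp: space_rho)
    have "(\<lambda>n. A u (snd (x n)) * levy_exponent \<nu> (g (fst (x n)) u)) \<longlonglongrightarrow>
        A u (snd a) * levy_exponent \<nu> (g (fst a) u)" if u: "0 < u" for u
    proof (rule tendsto_mult)
      have "(\<lambda>n. (\<lambda>(r, u). A r u) (u, snd (x n))) \<longlonglongrightarrow> (\<lambda>(r, u). A r u) (u, snd a)"
        by (rule continuous_on_tendsto_compose[OF A_cont])
           (use u xS aS lim in \<open>auto intro!: tendsto_intros\<close>)
      then show "(\<lambda>n. A u (snd (x n))) \<longlonglongrightarrow> A u (snd a)" by simp
      have "(\<lambda>n. (\<lambda>(s, u). g s u) (fst (x n), u)) \<longlonglongrightarrow> (\<lambda>(s, u). g s u) (fst a, u)"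
        by (rule continuous_on_tendsto_compose[OF cont])
           (use u xS aS lim in \<open>auto intro!: tendsto_intros\<close>)
      then have "(\<lambda>n. g (fst (x n)) u) \<longlonglongrightarrow> g (fst a) u" by simp
      then show "(\<lambda>n. levy_exponent \<nu> (g (fst (x n)) u)) \<longlonglongrightarrow> levy_exponent \<nu> (g (fst a) u)"
        by (rule continuous_on_tendsto_compose[OF levy_exponent_continuous])
           (use u xS aS bounds in auto)
    qed
    then show "AE u in \<rho>. (\<lambda>n. A u (snd (x n)) * levy_exponent \<nu> (g (fst (x n)) u)) \<longlonglongrightarrow>
        A u (snd a) * levy_exponent \<nu> (g (fst a) u)"
      by (auto simp: space_rho)
  qed (use jump_integrand_measurable gc bounds xS aS in auto)
  then show "((\<lambda>(s, r). jump_term \<nu> \<rho> A (g s) r) \<circ> x) \<longlonglongrightarrow> (\<lambda>(s, r). jump_term \<nu> \<rho> A (g s) r) a"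
    by (simp add: o_def split_beta jump_term_eq)
qed

end

section \<open>The constants and the source of the mild equation\<close>

locale riccati = jump_data \<nu> \<rho> A Abar for \<nu> \<rho> A Abar +
  fixes \<sigma> q :: real
  assumes subcritical: "Abar * moment \<nu> 1 < 1"
    and q_admissible: "q \<in> q_range \<sigma> \<nu> Abar"
begin

abbreviation "m \<equiv> Abar * moment \<nu> 1"
abbreviation "B \<equiv> phi_bar \<sigma> \<nu> Abar q"
abbreviation "\<eta> \<equiv> eta \<sigma> \<nu> Abar q"

text \<open>This is \<open>riccati_rhs / r + \<eta> * \<phi>\<close>. Raising the damping rate from
  \<open>1\<close> to \<open>\<eta>\<close> turns the quadratic part into a multiple of
  \<open>(B - \<phi>) * \<phi>\<close>, nonnegative for values in \<open>{0..B}\<close>.\<close>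

definition source :: "(real \<Rightarrow> real \<Rightarrow> real) \<Rightarrow> real \<Rightarrow> real \<Rightarrow> real" where
  "source \<phi> s r = 1 / 2 * \<sigma>\<^sup>2 * (B - \<phi> s r) * \<phi> s r + jump_term \<nu> \<rho> A (\<phi> s) r"

lemma mild_solution_iff:
  "mild_solution \<sigma> \<nu> \<rho> A Abar q \<phi> \<longleftrightarrow>
     (\<forall>T>0. \<phi> \<in> Cb T \<and> (\<forall>t\<in>{0..T}. \<forall>r>0. \<phi> t r = duhamel \<eta> q (source \<phi>) t r))"
  by (simp add: mild_solution_def duhamel_def source_def)

lemma m_nonneg: "0 \<le> m"
  using Abar_nonneg moment_1_nonneg by simp

lemma q_pos: "0 < q"
  using q_admissible by (auto simp: q_range_def split: if_splits)

lemma is_phi_bar_B: "is_phi_bar \<sigma> \<nu> Abar q B"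
  unfolding phi_bar_def by (rule theI'[OF phi_bar_unique[OF subcritical q_admissible]])

lemma B_nonneg: "0 \<le> B"
  using is_phi_bar_B by (simp add: is_phi_bar_def)

lemma eta_eq: "\<eta> = 1 + \<sigma>\<^sup>2 / 2 * B"
  by (simp add: eta_def)

lemma eta_pos: "0 < \<eta>"
  using B_nonneg by (simp add: eta_eq add_pos_nonneg)

lemma lipschitz_const_nonneg: "0 \<le> m + \<sigma>\<^sup>2 / 2 * B"
  by (rule add_nonneg_nonneg[OF m_nonneg]) (simp add: B_nonneg)

text \<open>The defining equation of \<open>B\<close> in the form used with the kernel mass: the
  largest source divided by \<open>\<eta>\<close> is \<open>B - q\<close>.\<close>

lemma B_eq: "B = q + (m + \<sigma>\<^sup>2 / 2 * B) * B / \<eta>"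
  using is_phi_bar_B unfolding is_phi_bar_def eta_eq by simp

lemma q_le_B: "q \<le> B"
proof -
  have "0 \<le> (m + \<sigma>\<^sup>2 / 2 * B) * B / \<eta>"
    by (intro divide_nonneg_pos mult_nonneg_nonneg lipschitz_const_nonneg B_nonneg eta_pos)
  then show ?thesis using B_eq by linarith
qed

lemma source_continuous:
  fixes S :: "real set"
  assumes "continuous_on (S \<times> {0<..}) (\<lambda>(s, u). \<phi> s u)"
    and "\<And>s u. s \<in> S \<Longrightarrow> 0 < u \<Longrightarrow> 0 \<le> \<phi> s u" "\<And>s u. s \<in> S \<Longrightarrow> 0 < u \<Longrightarrow> \<phi> s u \<le> K"
  shows "continuous_on (S \<times> {0<..}) (\<lambda>(s, r). source \<phi> s r)"
  using assms(1) jump_term_continuous[OF assms]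
  unfolding source_def split_beta by (intro continuous_intros)

section \<open>Regularity of nonnegative mild solutions\<close>

lemma mild_solution_continuous:
  assumes "mild_solution \<sigma> \<nu> \<rho> A Abar q \<phi>" "0 < T"
  shows "continuous_on ({0..T} \<times> {0<..}) (\<lambda>(s, u). \<phi> s u)"
  using assms unfolding mild_solution_def Cb_def by blast

lemma mild_solution_bounded:
  assumes "mild_solution \<sigma> \<nu> \<rho> A Abar q \<phi>" "0 < T"
  shows "\<exists>K. \<forall>s\<in>{0..T}. \<forall>u>0. \<phi> s u \<le> K"
proof -
  have "bounded ((\<lambda>(t, r). \<phi> t r) ` ({0..T} \<times> {0<..}))"
    using assms unfolding mild_solution_def Cb_def by blast
  then show ?thesis unfolding bounded_iff by (fastforce dest: abs_le_D1)
qed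

lemma mild_solution_duhamel:
  assumes "mild_solution \<sigma> \<nu> \<rho> A Abar q \<phi>" "0 \<le> t" "0 < r"
  shows "\<phi> t r = duhamel \<eta> q (source \<phi>) t r"
proof -
  \<comment> \<open>Horizons must be positive, so \<open>t + 1\<close> is chosen to cover
    \<open>t = 0\<close> as well.\<close>
  have "0 < t + 1" "t \<in> {0..t + 1}" using assms by auto
  then show ?thesis using assms unfolding mild_solution_iff by blast
qed

lemma mild_solution_source_continuous:
  assumes "mild_solution \<sigma> \<nu> \<rho> A Abar q \<phi>" "\<And>t r. 0 \<le> t \<Longrightarrow> 0 < r \<Longrightarrow> 0 \<le> \<phi> t r" "0 < T"
  shows "continuous_on ({0..T} \<times> {0<..}) (\<lambda>(s, u). source \<phi> s u)"
proof -
  obtain K where "\<forall>s\<in>{0..T}. \<forall>u>0. \<phi> s u \<le> K" using mild_solution_bounded[OF assms(1,3)] ..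
  with assms(2) show ?thesis
    by (intro source_continuous[OF mild_solution_continuous[OF assms(1,3)], where K = K]) auto
qed

text \<open>A mild solution is a Duhamel integral with continuous source. In its derivative,
  expanding \<open>\<eta>\<close> cancels the terms containing \<open>B\<close>.\<close>

lemma mild_solution_has_derivative:
  assumes "mild_solution \<sigma> \<nu> \<rho> A Abar q \<phi>" "\<And>t r. 0 \<le> t \<Longrightarrow> 0 < r \<Longrightarrow> 0 \<le> \<phi> t r"
    and t: "0 < t" and r: "0 < r"
  shows "((\<lambda>s. \<phi> s r) has_real_derivative riccati_rhs \<sigma> \<nu> \<rho> A (\<phi> t) r) (at t)"
proof -
  have c: "continuous_on ({0..t + 1} \<times> {0<..}) (\<lambda>(s, u). source \<phi> s u)"
    using mild_solution_source_continuous[OF assms(1,2)] t by simp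
  have "((\<lambda>s. duhamel \<eta> q (source \<phi>) s r) has_real_derivative
      (- \<eta> * r * duhamel \<eta> q (source \<phi>) t r + r * source \<phi> t r)) (at t)"
    using t r by (intro duhamel_has_derivative[where T = "t + 1"] continuous_on_section2[OF c]) auto
  \<comment> \<open>The Duhamel identity is known for nonnegative times only, so the derivative is
    transferred on an open interval of positive times.\<close>
  then have "((\<lambda>s. \<phi> s r) has_real_derivative
      (- \<eta> * r * duhamel \<eta> q (source \<phi>) t r + r * source \<phi> t r)) (at t)"
    by (rule has_field_derivative_transform_within_open[where S = "{0<..<t + 1}"])
       (use t r mild_solution_duhamel[OF assms(1)] in auto)
  moreover have "- \<eta> * r * duhamel \<eta> q (source \<phi>) t r + r * source \<phi> t r = riccati_rhs \<sigma> \<nu> \<rho> A (\<phi> t) r"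
    using mild_solution_duhamel[OF assms(1), of t r, symmetric] t r
    by (simp add: riccati_rhs_def source_def eta_eq algebra_simps power2_eq_square)
  ultimately show ?thesis by simp
qed

section \<open>Uniqueness among nonnegative solutions\<close>

text \<open>The difference \<open>D\<close> of two solutions satisfies
  \<open>D' = - r (1 + \<sigma>\<^sup>2/2 (\<phi> + \<psi>)) D + r (J \<phi> - J \<psi>)\<close> with \<open>\<bar>J \<phi> - J \<psi>\<bar> \<le> m d\<close>, so it cannot
  have a maximum above \<open>m d\<close>.\<close>

lemma mild_solution_diff_le:
  assumes \<phi>: "mild_solution \<sigma> \<nu> \<rho> A Abar q \<phi>" "\<And>t r. 0 \<le> t \<Longrightarrow> 0 < r \<Longrightarrow> 0 \<le> \<phi> t r"
    and \<psi>: "mild_solution \<sigma> \<nu> \<rho> A Abar q \<psi>" "\<And>t r. 0 \<le> t \<Longrightarrow> 0 < r \<Longrightarrow> 0 \<le> \<psi> t r"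
    and T: "0 < T" and d: "\<And>t r. t \<in> {0..T} \<Longrightarrow> 0 < r \<Longrightarrow> \<bar>\<phi> t r - \<psi> t r\<bar> \<le> d"
    and t: "t \<in> {0..T}" and r: "0 < r"
  shows "\<phi> t r - \<psi> t r \<le> m * d"
proof -
  obtain K where K: "\<forall>s\<in>{0..T}. \<forall>u>0. \<phi> s u \<le> K"
    using mild_solution_bounded[OF \<phi>(1) T] ..
  obtain L where L: "\<forall>s\<in>{0..T}. \<forall>u>0. \<psi> s u \<le> L"
    using mild_solution_bounded[OF \<psi>(1) T] ..
  note cont = mild_solution_continuous[OF \<phi>(1) T] mild_solution_continuous[OF \<psi>(1) T]
  have d0: "0 \<le> d" using d[OF t r] by simp
  have "\<phi> 0 r = \<psi> 0 r" using mild_solution_duhamel[OF \<phi>(1), of 0 r] mild_solution_duhamel[OF \<psi>(1), of 0 r] r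
    by (simp add: duhamel_def)
  show ?thesis
  proof (rule bounded_by_if_derivative_neg_above[where D = "\<lambda>t. \<phi> t r - \<psi> t r", OF _ _ _ t])
    show "continuous_on {0..T} (\<lambda>t. \<phi> t r - \<psi> t r)"
      by (intro continuous_on_diff continuous_on_section2[OF cont(1) r] continuous_on_section2[OF cont(2) r]) auto
    show "\<phi> 0 r - \<psi> 0 r \<le> m * d" using \<open>\<phi> 0 r = \<psi> 0 r\<close> m_nonneg d0 by simp
  next
    fix s assume s: "0 < s" "s \<le> T" and above: "m * d < \<phi> s r - \<psi> s r"
    define l where "l = riccati_rhs \<sigma> \<nu> \<rho> A (\<phi> s) r - riccati_rhs \<sigma> \<nu> \<rho> A (\<psi> s) r"
    have s': "s \<in> {0..T}" using s by simp
    have "\<bar>jump_term \<nu> \<rho> A (\<phi> s) r - jump_term \<nu> \<rho> A (\<psi> s) r\<bar> \<le> m * d"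
      using s \<phi>(2) \<psi>(2) d K L r
      by (intro jump_term_diff[where K = K and L = L] continuous_on_section[OF cont(1) s']
          continuous_on_section[OF cont(2) s']) auto
    then have "r * (jump_term \<nu> \<rho> A (\<phi> s) r - jump_term \<nu> \<rho> A (\<psi> s) r) < r * (\<phi> s r - \<psi> s r)"
      using above r by (intro mult_strict_left_mono) auto
    \<comment> \<open>The threshold \<open>m * d\<close> is nonnegative, so the difference is
      nonnegative here and the quadratic term pushes it down, whatever the size of the
      solutions.\<close>
    moreover have "0 \<le> 1 / 2 * \<sigma>\<^sup>2 * r * ((\<phi> s r + \<psi> s r) * (\<phi> s r - \<psi> s r))"
    proof -
      have "0 \<le> m * d" using m_nonneg d0 by simp
      with above have "0 \<le> \<phi> s r - \<psi> s r" by linarith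
      then show ?thesis
        using s r \<phi>(2)[of s r] \<psi>(2)[of s r] by (intro mult_nonneg_nonneg add_nonneg_nonneg) auto
    qed
    moreover have "l = r * (jump_term \<nu> \<rho> A (\<phi> s) r - jump_term \<nu> \<rho> A (\<psi> s) r) - r * (\<phi> s r - \<psi> s r)
        - 1 / 2 * \<sigma>\<^sup>2 * r * ((\<phi> s r + \<psi> s r) * (\<phi> s r - \<psi> s r))"
      by (simp add: l_def riccati_rhs_def algebra_simps power2_eq_square)
    ultimately have "l < 0" by linarith
    moreover have "((\<lambda>t. \<phi> t r - \<psi> t r) has_real_derivative l) (at s)"
      unfolding l_def using s r \<phi> \<psi> by (intro DERIV_diff mild_solution_has_derivative) auto
    ultimately show "\<exists>l<0. ((\<lambda>t. \<phi> t r - \<psi> t r) has_real_derivative l) (at s)" by blast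
  qed
qed

text \<open>The one-sided estimate, used in both orders, gives \<open>S \<le> m * S\<close> with
  \<open>m < 1\<close> for the uniform distance \<open>S\<close>. This works on any finite horizon
  at once, without iterating over short intervals.\<close>

lemma mild_solution_unique:
  assumes \<phi>: "mild_solution \<sigma> \<nu> \<rho> A Abar q \<phi>" "\<And>t r. 0 \<le> t \<Longrightarrow> 0 < r \<Longrightarrow> 0 \<le> \<phi> t r"
    and \<psi>: "mild_solution \<sigma> \<nu> \<rho> A Abar q \<psi>" "\<And>t r. 0 \<le> t \<Longrightarrow> 0 < r \<Longrightarrow> 0 \<le> \<psi> t r"
    and t: "0 \<le> t" and r: "0 < r"
  shows "\<psi> t r = \<phi> t r"
proof -
  define T where "T = t + 1"
  have T: "0 < T" "t \<in> {0..T}" using t by (auto simp: T_def)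
  obtain K where K: "\<forall>s\<in>{0..T}. \<forall>u>0. \<phi> s u \<le> K"
    using mild_solution_bounded[OF \<phi>(1) T(1)] ..
  obtain L where L: "\<forall>s\<in>{0..T}. \<forall>u>0. \<psi> s u \<le> L"
    using mild_solution_bounded[OF \<psi>(1) T(1)] ..
  define S where "S = (SUP p\<in>{0..T} \<times> {0<..}. \<bar>\<phi> (fst p) (snd p) - \<psi> (fst p) (snd p)\<bar>)"
  have S: "\<bar>\<phi> s u - \<psi> s u\<bar> \<le> S" if "s \<in> {0..T}" "0 < u" for s u
  proof -
    \<comment> \<open>Nonnegativity turns the two upper bounds into a bound on the absolute
      difference, so the supremum \<open>S\<close> is finite.\<close>
    have "\<bar>\<phi> s u - \<psi> s u\<bar> \<le> K + L" if "s \<in> {0..T}" "0 < u" for s u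
      using K[rule_format, OF that] L[rule_format, OF that] \<phi>(2)[of s u] \<psi>(2)[of s u] that by (simp add: abs_le_iff)
    then have "bdd_above ((\<lambda>p. \<bar>\<phi> (fst p) (snd p) - \<psi> (fst p) (snd p)\<bar>) ` ({0..T} \<times> {0<..}))"
      by (intro bdd_aboveI2[where M = "K + L"]) (auto simp: mem_Times_iff)
    then show ?thesis
      unfolding S_def using that by (intro cSUP_upper2[where x = "(s, u)"]) auto
  qed
  have "\<bar>\<phi> s u - \<psi> s u\<bar> \<le> m * S" if "s \<in> {0..T}" "0 < u" for s u
    using mild_solution_diff_le[OF \<phi> \<psi> T(1) S that] mild_solution_diff_le[OF \<psi> \<phi> T(1) _ that, of S] S
    by (simp add: abs_le_iff)
  then have "(SUP p\<in>{0..T} \<times> {0<..}. \<bar>\<phi> (fst p) (snd p) - \<psi> (fst p) (snd p)\<bar>) \<le> m * S"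
    using T r by (intro cSUP_least) (auto simp: mem_Times_iff)
  then have "S \<le> m * S" unfolding S_def[symmetric] .
  then have "(1 - m) * S \<le> 0" by (simp add: algebra_simps)
  then have "S \<le> 0" using subcritical by (simp add: mult_le_0_iff)
  then show ?thesis using S[OF T(2) r] by simp
qed

section \<open>Existence: invariance of \<open>{0..B}\<close> and contraction\<close>

text \<open>Both factors of the quadratic part are bounded by \<open>B\<close> separately. Crude as
  this is, it is the very amount that the equation for \<open>B\<close> absorbs.\<close>

lemma source_bounds:
  assumes "continuous_on {0<..} (\<phi> s)" "\<And>u. 0 < u \<Longrightarrow> 0 \<le> \<phi> s u" "\<And>u. 0 < u \<Longrightarrow> \<phi> s u \<le> B" "0 < r"
  shows "0 \<le> source \<phi> s r" "source \<phi> s r \<le> (m + \<sigma>\<^sup>2 / 2 * B) * B"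
proof -
  note J = jump_term_bounds[OF assms(1-3,4)]
  have "(B - \<phi> s r) * \<phi> s r \<le> B * B"
    using assms(2-4) B_nonneg by (intro mult_mono) auto
  then have "1 / 2 * \<sigma>\<^sup>2 * ((B - \<phi> s r) * \<phi> s r) \<le> 1 / 2 * \<sigma>\<^sup>2 * (B * B)"
    by (intro mult_left_mono) auto
  then show "source \<phi> s r \<le> (m + \<sigma>\<^sup>2 / 2 * B) * B"
    using J(2) unfolding source_def distrib_right mult.assoc by linarith
  show "0 \<le> source \<phi> s r"
    unfolding source_def using J(1) assms by (intro add_nonneg_nonneg mult_nonneg_nonneg) auto
qed

text \<open>The quadratic parts differ by a multiple of
  \<open>(B - \<phi> - \<psi>) * (\<phi> - \<psi>)\<close>, and the first factor lies between
  \<open>- B\<close> and \<open>B\<close> when both functions take values in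
  \<open>{0..B}\<close>.\<close>

lemma source_diff:
  assumes \<phi>: "continuous_on {0<..} (\<phi> s)" "\<And>u. 0 < u \<Longrightarrow> 0 \<le> \<phi> s u" "\<And>u. 0 < u \<Longrightarrow> \<phi> s u \<le> B"
    and \<psi>: "continuous_on {0<..} (\<psi> s)" "\<And>u. 0 < u \<Longrightarrow> 0 \<le> \<psi> s u" "\<And>u. 0 < u \<Longrightarrow> \<psi> s u \<le> B"
    and d: "\<And>u. 0 < u \<Longrightarrow> \<bar>\<phi> s u - \<psi> s u\<bar> \<le> d" and r: "0 < r"
  shows "source \<phi> s r - source \<psi> s r \<le> (m + \<sigma>\<^sup>2 / 2 * B) * d"
proof -
  have J: "jump_term \<nu> \<rho> A (\<phi> s) r - jump_term \<nu> \<rho> A (\<psi> s) r \<le> m * d"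
    using jump_term_diff[OF \<phi> \<psi> d r] by linarith
  have "(B - \<phi> s r - \<psi> s r) * (\<phi> s r - \<psi> s r) \<le> \<bar>B - \<phi> s r - \<psi> s r\<bar> * \<bar>\<phi> s r - \<psi> s r\<bar>"
    by (simp add: abs_mult[symmetric])
  also have "\<dots> \<le> B * d"
    using \<phi>(2,3)[OF r] \<psi>(2,3)[OF r] d[OF r] B_nonneg by (intro mult_mono) (auto simp: abs_le_iff)
  finally have "1 / 2 * \<sigma>\<^sup>2 * ((B - \<phi> s r - \<psi> s r) * (\<phi> s r - \<psi> s r)) \<le> 1 / 2 * \<sigma>\<^sup>2 * (B * d)"
    by (intro mult_left_mono) auto
  moreover have "source \<phi> s r - source \<psi> s r =
      1 / 2 * \<sigma>\<^sup>2 * ((B - \<phi> s r - \<psi> s r) * (\<phi> s r - \<psi> s r))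
      + (jump_term \<nu> \<rho> A (\<phi> s) r - jump_term \<nu> \<rho> A (\<psi> s) r)"
    by (simp add: source_def field_simps)
  moreover have "(m + \<sigma>\<^sup>2 / 2 * B) * d = m * d + 1 / 2 * \<sigma>\<^sup>2 * (B * d)"
    by (simp add: distrib_right)
  ultimately show ?thesis using J by linarith
qed

lemma duhamel_source_le:
  assumes "0 \<le> t" "0 < r" "continuous_on ({0..} \<times> {0<..}) (\<lambda>(s, u). \<phi> s u)"
    and "\<And>s u. 0 \<le> s \<Longrightarrow> 0 < u \<Longrightarrow> 0 \<le> \<phi> s u" "\<And>s u. 0 \<le> s \<Longrightarrow> 0 < u \<Longrightarrow> \<phi> s u \<le> B"
  shows "0 \<le> duhamel \<eta> q (source \<phi>) t r" "duhamel \<eta> q (source \<phi>) t r \<le> B"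
proof -
  have sec: "continuous_on {0<..} (\<phi> s)" if "0 \<le> s" for s
    using continuous_on_section[OF assms(3)] that by simp
  have c: "continuous_on {0..t} (\<lambda>s. source \<phi> s r)"
    using assms by (intro continuous_on_section2[OF source_continuous[OF assms(3)], where K1 = B]) auto
  show "0 \<le> duhamel \<eta> q (source \<phi>) t r"
    using assms q_pos sec by (intro duhamel_nonneg c source_bounds) auto
  define e where "e = exp (- \<eta> * r * t)"
  have e: "0 \<le> e" "e \<le> 1" using eta_pos assms by (auto simp: e_def)
  have "duhamel \<eta> q (source \<phi>) t r \<le> q * e + (m + \<sigma>\<^sup>2 / 2 * B) * B / \<eta> * (1 - e)"
    unfolding e_def using assms sec eta_pos by (intro duhamel_upper_bound c source_bounds) auto
  \<comment> \<open>The choice of \<open>B\<close> enters here. With \<open>e\<close> in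
    \<open>{0..1}\<close> the bound becomes \<open>q * e + (B - q) * (1 - e)\<close>, which is at
    most \<open>q + (B - q)\<close>.\<close>
  also have "(m + \<sigma>\<^sup>2 / 2 * B) * B / \<eta> = B - q" using B_eq by linarith
  also have "q * e + (B - q) * (1 - e) = B - (q * (1 - e) + (B - q) * e)" by (simp add: algebra_simps)
  also have "0 \<le> q * (1 - e) + (B - q) * e" using e q_pos q_le_B by simp
  then have "B - (q * (1 - e) + (B - q) * e) \<le> B" by linarith
  finally show "duhamel \<eta> q (source \<phi>) t r \<le> B" .
qed

text \<open>The common initial datum cancels, leaving the source estimate times the kernel mass
  \<open>1 / \<eta>\<close>.\<close>

lemma duhamel_source_diff:
  assumes "0 \<le> t" "0 < r"
    and \<phi>: "continuous_on ({0..} \<times> {0<..}) (\<lambda>(s, u). \<phi> s u)"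
      "\<And>s u. 0 \<le> s \<Longrightarrow> 0 < u \<Longrightarrow> 0 \<le> \<phi> s u" "\<And>s u. 0 \<le> s \<Longrightarrow> 0 < u \<Longrightarrow> \<phi> s u \<le> B"
    and \<psi>: "continuous_on ({0..} \<times> {0<..}) (\<lambda>(s, u). \<psi> s u)"
      "\<And>s u. 0 \<le> s \<Longrightarrow> 0 < u \<Longrightarrow> 0 \<le> \<psi> s u" "\<And>s u. 0 \<le> s \<Longrightarrow> 0 < u \<Longrightarrow> \<psi> s u \<le> B"
    and d: "\<And>s u. 0 \<le> s \<Longrightarrow> 0 < u \<Longrightarrow> \<bar>\<phi> s u - \<psi> s u\<bar> \<le> d"
  shows "duhamel \<eta> q (source \<phi>) t r - duhamel \<eta> q (source \<psi>) t r \<le> (m + \<sigma>\<^sup>2 / 2 * B) / \<eta> * d"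
proof -
  have c: "continuous_on {0..t} (\<lambda>s. source \<phi> s r)" "continuous_on {0..t} (\<lambda>s. source \<psi> s r)"
    using assms by (auto intro!: continuous_on_section2[OF source_continuous[OF \<phi>(1), where K = B]]
       continuous_on_section2[OF source_continuous[OF \<psi>(1), where K = B]])
  have "0 \<le> d" using d[OF assms(1,2)] by simp
  have "duhamel \<eta> 0 (\<lambda>s r. source \<phi> s r - source \<psi> s r) t r \<le> (m + \<sigma>\<^sup>2 / 2 * B) * d / \<eta>"
  proof (rule duhamel_zero_upper_bound)
    show "source \<phi> s r - source \<psi> s r \<le> (m + \<sigma>\<^sup>2 / 2 * B) * d" if "s \<in> {0..t}" for s
      using assms that by (intro source_diff continuous_on_section[OF \<phi>(1)] continuous_on_section[OF \<psi>(1)]) auto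
    show "0 \<le> (m + \<sigma>\<^sup>2 / 2 * B) * d"
      by (intro mult_nonneg_nonneg lipschitz_const_nonneg \<open>0 \<le> d\<close>)
  qed (use assms eta_pos c in \<open>auto intro!: continuous_on_diff\<close>)
  then show ?thesis using duhamel_diff[of t "source \<phi>" r "source \<psi>"] c by simp
qed

text \<open>To use the Banach space of bounded continuous functions on the whole plane, the quarter plane
  is parametrised by \<open>(x, y) \<mapsto> (max x 0, exp y)\<close>. The fixed-point map contracts uniformly in time:
  the Duhamel kernel has mass at most \<open>1 / \<eta>\<close> and \<open>m + \<sigma>\<^sup>2/2 B < \<eta>\<close>.\<close>

lemma mild_solution_exists:
  "\<exists>\<phi>. mild_solution \<sigma> \<nu> \<rho> A Abar q \<phi> \<and>
     continuous_on ({0..} \<times> {0<..}) (\<lambda>(s, u). \<phi> s u) \<and>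
     (\<forall>t\<ge>0. \<forall>r>0. 0 \<le> \<phi> t r \<and> \<phi> t r \<le> B)"
proof -
  \<comment> \<open>\<open>ext\<close> reads a function on the plane in quarter-plane coordinates.
    \<open>W\<close> writes the Duhamel image back, frozen at its time-zero value for negative first
    coordinates.\<close>
  define ext where "ext = (\<lambda>(f :: (real \<times> real) \<Rightarrow>\<^sub>C real) t r. apply_bcontfun f (t, ln r))"
  define W where "W = (\<lambda>f p. duhamel \<eta> q (source (ext f)) (max (fst p) 0) (exp (snd p)))"
  \<comment> \<open>\<open>Bcontfun\<close> is meaningful only on bounded continuous functions;
    \<open>Wc\<close> provides this for \<open>f\<close> in \<open>S\<close>, and \<open>F\<close>
    is evaluated only there.\<close>
  define F where "F = (\<lambda>f. Bcontfun (W f))"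
  \<comment> \<open>Values in \<open>{0..B}\<close> give the quadratic part its Lipschitz constant.
    The set is closed, hence complete, in the supremum norm.\<close>
  define S where "S = PiC UNIV (\<lambda>_ :: real \<times> real. {0..B})"
  have extc: "continuous_on ({0..} \<times> {0<..}) (\<lambda>(s, u). ext f s u)" for f
  proof -
    have "continuous_on ({0..} \<times> {0<..}) (\<lambda>p. apply_bcontfun f (fst p, ln (snd p)))"
      by (rule continuous_on_compose2[of UNIV "apply_bcontfun f"])
         (auto intro!: continuous_intros)
    then show ?thesis by (simp add: ext_def split_beta)
  qed
  have extb: "0 \<le> ext f s u" "ext f s u \<le> B" if "f \<in> S" for f s u
    using that by (auto simp: S_def mem_PiC_iff ext_def Pi_iff)
  have Wb: "W f p \<in> {0..B}" if "f \<in> S" for f p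
    unfolding W_def using duhamel_source_le[OF _ _ extc] extb[OF that] by simp
  have Wc: "W f \<in> bcontfun" if "f \<in> S" for f
  proof (rule bcontfun_normI)
    have "continuous_on ({0..} \<times> {0<..}) (\<lambda>(t, r). duhamel \<eta> q (source (ext f)) t r)"
      using extb[OF that] by (intro duhamel_continuous source_continuous[OF extc, where K = B]) auto
    then have "continuous_on UNIV (\<lambda>p. (\<lambda>(t, r). duhamel \<eta> q (source (ext f)) t r) (max (fst p) 0, exp (snd p)))"
      by (rule continuous_on_compose2) (auto intro!: continuous_intros)
    then show "continuous_on UNIV (W f)" by (simp add: W_def)
    show "norm (W f p) \<le> B" for p using Wb[OF that, of p] by simp
  qed
  have F: "apply_bcontfun (F f) = W f" if "f \<in> S" for f
    unfolding F_def using Wc[OF that] by (rule Bcontfun_inverse)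
  have "\<exists>!f\<in>S. F f = f"
  proof (rule Banach_fix[where c = "(m + \<sigma>\<^sup>2 / 2 * B) / \<eta>"])
    show "Topological_Spaces.complete S"
      unfolding S_def complete_eq_closed by (intro closed_PiC) auto
    have "const_bcontfun 0 \<in> S" using B_nonneg by (auto simp: S_def mem_PiC_iff const_bcontfun.rep_eq)
    then show "S \<noteq> {}" by auto
    show "0 \<le> (m + \<sigma>\<^sup>2 / 2 * B) / \<eta>"
      by (intro divide_nonneg_pos lipschitz_const_nonneg eta_pos)
    \<comment> \<open>\<open>\<eta>\<close> exceeds the numerator by \<open>1 - m\<close>.\<close>
    show "(m + \<sigma>\<^sup>2 / 2 * B) / \<eta> < 1"
      using eta_pos subcritical by (simp add: eta_eq)
    show "F ` S \<subseteq> S"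
      using Wb F by (auto simp: S_def mem_PiC_iff Pi_iff)
    fix f g assume fg: "f \<in> S" "g \<in> S"
    show "dist (F f) (F g) \<le> (m + \<sigma>\<^sup>2 / 2 * B) / \<eta> * dist f g"
    proof (rule dist_bound)
      fix p
      \<comment> \<open>Both orders are prepared because \<open>duhamel_source_diff\<close> is
        one-sided.\<close>
      have "\<bar>ext f s u - ext g s u\<bar> \<le> dist f g" "\<bar>ext g s u - ext f s u\<bar> \<le> dist f g" for s u
        using dist_bounded[of f "(s, ln u)" g] by (auto simp: ext_def dist_real_def abs_minus_commute)
      then have "W f p - W g p \<le> (m + \<sigma>\<^sup>2 / 2 * B) / \<eta> * dist f g"
        "W g p - W f p \<le> (m + \<sigma>\<^sup>2 / 2 * B) / \<eta> * dist f g"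
        unfolding W_def using extb fg by (intro duhamel_source_diff extc; simp)+
      then show "dist (apply_bcontfun (F f) p) (apply_bcontfun (F g) p) \<le> (m + \<sigma>\<^sup>2 / 2 * B) / \<eta> * dist f g"
        using F fg by (simp add: dist_real_def abs_le_iff)
    qed
  qed
  then obtain f where f: "f \<in> S" "F f = f" by auto
  have "ext f t r = duhamel \<eta> q (source (ext f)) t r" if "0 \<le> t" "0 < r" for t r
  proof -
    \<comment> \<open>Evaluating the fixed point at a nonnegative time and at \<open>ln r\<close>
      makes the clamp and the exponential disappear.\<close>
    have "ext f t r = W f (t, ln r)" using F[OF f(1)] f(2) by (simp add: ext_def)
    then show ?thesis using that by (simp add: W_def)
  qed
  moreover have "ext f \<in> Cb T" for T
    unfolding Cb_def bounded_iff using extb[OF f(1)]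
    by (auto intro!: continuous_on_subset[OF extc] exI[of _ B])
  ultimately have "mild_solution \<sigma> \<nu> \<rho> A Abar q (ext f)"
    unfolding mild_solution_iff by auto
  then show ?thesis using extc extb[OF f(1)] by blast
qed

section \<open>Continuous differentiability in time and the conclusion\<close>

text \<open>Continuity of the time derivative along the solution, which upgrades differentiability
  to \<open>C1\<close>.\<close>

lemma riccati_rhs_continuous:
  assumes c: "continuous_on ({0..} \<times> {0<..}) (\<lambda>(s, u). \<phi> s u)"
    and b: "\<And>t r. 0 \<le> t \<Longrightarrow> 0 < r \<Longrightarrow> 0 \<le> \<phi> t r" "\<And>t r. 0 \<le> t \<Longrightarrow> 0 < r \<Longrightarrow> \<phi> t r \<le> B"
    and r: "0 < r"
  shows "continuous_on {0<..} (\<lambda>t :: real. riccati_rhs \<sigma> \<nu> \<rho> A (\<phi> t) r)"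
proof -
  have "continuous_on {0<..} (\<lambda>t. \<phi> t r)" by (rule continuous_on_section2[OF c r]) auto
  moreover have "continuous_on {0<..} (\<lambda>t. jump_term \<nu> \<rho> A (\<phi> t) r)"
    by (rule continuous_on_section2[OF jump_term_continuous[OF c, where K = B] r]) (use b in auto)
  ultimately show ?thesis unfolding riccati_rhs_def by (intro continuous_intros)
qed

end

theorem proposition1:
  fixes \<sigma> Abar q :: real
    and \<nu> \<rho> :: "real measure"
    and A :: "real \<Rightarrow> real \<Rightarrow> real"
  assumes "0 \<le> \<sigma>"
    and "levy_measure \<nu>"
    and "prob_space \<rho>"
    and "\<And>r u. 0 < r \<Longrightarrow> 0 < u \<Longrightarrow> 0 \<le> A r u"
    and "uniformly_continuous_on ({0<..} \<times> {0<..}) (\<lambda>(r, u). A r u)"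
    and "0 < Abar"
    and "\<And>r u. 0 < r \<Longrightarrow> 0 < u \<Longrightarrow> A r u \<le> Abar"
    and "integrable \<nu> (\<lambda>z. z ^ 1)"
    and "integrable \<nu> (\<lambda>z. z ^ 2)"
    and "Abar * moment \<nu> 1 < 1"
    and "has_bounded_positive_density \<rho>"
    and "integrable \<rho> (\<lambda>r. r)"
    and "q \<in> q_range \<sigma> \<nu> Abar"
  shows "\<exists>\<phi>.
      mild_solution \<sigma> \<nu> \<rho> A Abar q \<phi> \<and>
      (\<forall>t\<ge>0. \<forall>r>0. 0 \<le> \<phi> t r \<and> \<phi> t r \<le> phi_bar \<sigma> \<nu> Abar q) \<and>
      (\<forall>\<psi>. mild_solution \<sigma> \<nu> \<rho> A Abar q \<psi> \<and> (\<forall>t\<ge>0. \<forall>r>0. 0 \<le> \<psi> t r) \<longrightarrow>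
           (\<forall>t\<ge>0. \<forall>r>0. \<psi> t r = \<phi> t r)) \<and>
      (\<forall>r>0. (\<lambda>t. \<phi> t r) C1_differentiable_on {0<..}) \<and>
      (\<forall>t>0. \<forall>r>0. ((\<lambda>s. \<phi> s r) has_real_derivative riccati_rhs \<sigma> \<nu> \<rho> A (\<phi> t) r) (at t))"
proof -
  interpret riccati \<nu> \<rho> A Abar \<sigma> q
  proof (intro riccati.intro jump_data.intro riccati_axioms.intro)
    show "sets \<nu> = sets (restrict_space borel {0<..})"
      using assms(2) by (simp add: levy_measure_def)
    \<comment> \<open>A density keeps the sigma-algebra of its base measure, here Lebesgue measure
      on the positive half line.\<close>
    show "sets \<rho> = sets (restrict_space borel {0<..})"
      using assms(11) by (auto simp: has_bounded_positive_density_def cong: sets_restrict_space_cong)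
    show "integrable \<nu> (\<lambda>z. z)" using assms(8) by simp
    show "continuous_on ({0<..} \<times> {0<..}) (\<lambda>(r, u). A r u)"
      using assms(5) by (rule uniformly_continuous_imp_continuous)
  qed (fact assms)+
  obtain \<phi> where sol: "mild_solution \<sigma> \<nu> \<rho> A Abar q \<phi>"
    and cont: "continuous_on ({0..} \<times> {0<..}) (\<lambda>(s, u). \<phi> s u)"
    and bounds: "\<forall>t\<ge>0. \<forall>r>0. 0 \<le> \<phi> t r \<and> \<phi> t r \<le> B"
    using mild_solution_exists by blast
  have deriv: "((\<lambda>s. \<phi> s r) has_real_derivative riccati_rhs \<sigma> \<nu> \<rho> A (\<phi> t) r) (at t)"
    if "0 < t" "0 < r" for t r
    using mild_solution_has_derivative[OF sol] bounds that by simp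
  have C1: "(\<lambda>t. \<phi> t r) C1_differentiable_on {0<..}" if r: "0 < r" for r
    unfolding C1_differentiable_on_def
    using deriv[OF _ r] riccati_rhs_continuous[OF cont _ _ r] bounds
    by (intro exI[of _ "\<lambda>t. riccati_rhs \<sigma> \<nu> \<rho> A (\<phi> t) r"])
       (auto simp: has_real_derivative_iff_has_vector_derivative)
  \<comment> \<open>Competitors are only assumed nonnegative; the bound by \<open>B\<close> follows
    for them from equality with \<open>\<phi>\<close>.\<close>
  have unique: "\<psi> t r = \<phi> t r"
    if "mild_solution \<sigma> \<nu> \<rho> A Abar q \<psi>" "\<forall>t\<ge>0. \<forall>r>0. 0 \<le> \<psi> t r" "0 \<le> t" "0 < r" for \<psi> t r
    using mild_solution_unique[OF sol] bounds that by simp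
  show ?thesis
    by (intro exI[of _ \<phi>] conjI sol bounds) (use C1 deriv unique in blast)+
qed

end
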